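(* Let $(X,p)$ be a heap, $R$ and $S$ two congruences on $(X,p)$, and fix an element $e\in X$. Let $N:=[e]_R$ and $M:=[e]_S$ be the normal subgroups of the group $(X,b_e)$ corresponding to the congruences $R$ and $S$ respectively. Then the commutator $[R,S]$ of $R$ and $S$ is the congruence on $(X,p)$ corresponding to the normal subgroup $[N,M]$ of the group $(X,b_e)$ (the subgroup generated by all group commutators $nmn^{-1}m^{-1}$ with $n\in N$, $m\in M$).
   Context: A heap is a set $X$ with a ternary operation $p(x,y,z)=[x,y,z]$ such that $[[x,y,z],w,u]=[x,y,[z,w,u]]$, $[x,x,y]=y$ and $[x,y,y]=x$ for all $x,y,z,w,u\in X$. Heap morphisms are the maps preserving the ternary operation. A congruence on a heap is an equivalence relation compatible with the ternary operation. For $e\in X$, $b_e$ is the binary operation $b_e(x,z)=[x,e,z]$; $(X,b_e)$ is a group with identity $e$. It is known that $\sim\ \mapsto [e]_\sim$ (the equivalence class of $e$) is a lattice isomorphism from the lattice of congruences on the heap $X$ onto the lattice of normal subgroups of the group $(X,b_e)$; this is the meaning of "corresponding". The congruence corresponding to a normal subgroup $C$ is: $x\sim_C y$ iff there exists $s\in C$ with $[x,y,s]\in C$. For congruences $R,S$ on $X$, let $R\times_X S=\{(x,y,z)\in X^3\mid x\,R\,y \text{ and } y\,S\,z\}$, a subheap of $X^3$. The commutator $[R,S]$ is the smallest congruence $T$ on the heap $X$ such that the map $R\times_X S\to X/T$, $(x,y,z)\mapsto [\,[x,y,z]\,]_{T}$ (the $T$-class of $[x,y,z]$), is a heap morphism.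 *)

theory Defs
  imports "HOL-Algebra.Generated_Groups"
begin

locale heap =
  fixes X :: "'a set" and p :: "'a \<Rightarrow> 'a \<Rightarrow> 'a \<Rightarrow> 'a"
  assumes closed: "\<lbrakk>x \<in> X; y \<in> X; z \<in> X\<rbrakk> \<Longrightarrow> p x y z \<in> X"
    and assoc: "\<lbrakk>x \<in> X; y \<in> X; z \<in> X; w \<in> X; u \<in> X\<rbrakk>
                  \<Longrightarrow> p (p x y z) w u = p x y (p z w u)"
    and left_cancel: "\<lbrakk>x \<in> X; y \<in> X\<rbrakk> \<Longrightarrow> p x x y = y"
    and right_cancel: "\<lbrakk>x \<in> X; y \<in> X\<rbrakk> \<Longrightarrow> p x y y = x"

definition heap_hom ::
    "'a set \<Rightarrow> ('a \<Rightarrow> 'a \<Rightarrow> 'a \<Rightarrow> 'a) \<Rightarrow> 'b set \<Rightarrow> ('b \<Rightarrow> 'b \<Rightarrow> 'b \<Rightarrow> 'b) \<Rightarrow> ('a \<Rightarrow> 'b) set"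
  where "heap_hom X p Y q =
    {f \<in> X \<rightarrow> Y. \<forall>x\<in>X. \<forall>y\<in>X. \<forall>z\<in>X. f (p x y z) = q (f x) (f y) (f z)}"

definition heap_congruence :: "'a set \<Rightarrow> ('a \<Rightarrow> 'a \<Rightarrow> 'a \<Rightarrow> 'a) \<Rightarrow> ('a \<times> 'a) set \<Rightarrow> bool"
  where "heap_congruence X p T \<longleftrightarrow> equiv X T \<and>
    (\<forall>x x' y y' z z'. (x, x') \<in> T \<longrightarrow> (y, y') \<in> T \<longrightarrow> (z, z') \<in> T
       \<longrightarrow> (p x y z, p x' y' z') \<in> T)"

text \<open>The operation of the quotient heap, whose carrier is \<open>X // T\<close>; see
  \<open>quot_op_class\<close> below.\<close>

definition quot_op ::
    "('a \<Rightarrow> 'a \<Rightarrow> 'a \<Rightarrow> 'a) \<Rightarrow> ('a \<times> 'a) set \<Rightarrow> 'a set \<Rightarrow> 'a set \<Rightarrow> 'a set \<Rightarrow> 'a set"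
  where "quot_op p T A B C = T `` {p x y z | x y z. x \<in> A \<and> y \<in> B \<and> z \<in> C}"

definition triple_op ::
    "('a \<Rightarrow> 'a \<Rightarrow> 'a \<Rightarrow> 'a) \<Rightarrow> 'a \<times> 'a \<times> 'a \<Rightarrow> 'a \<times> 'a \<times> 'a \<Rightarrow> 'a \<times> 'a \<times> 'a \<Rightarrow> 'a \<times> 'a \<times> 'a"
  where "triple_op p = (\<lambda>(x, y, z) (x', y', z') (x'', y'', z'').
    (p x x' x'', p y y' y'', p z z' z''))"

text \<open>\<open>R \<times>\<^sub>X S\<close>; it lies in \<open>X\<^sup>3\<close> as soon as \<open>R\<close> and \<open>S\<close> are congruences on \<open>X\<close>.\<close>

definition fibre_prod :: "('a \<times> 'a) set \<Rightarrow> ('a \<times> 'a) set \<Rightarrow> ('a \<times> 'a \<times> 'a) set"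
  where "fibre_prod R S = {(x, y, z). (x, y) \<in> R \<and> (y, z) \<in> S}"

definition centralizing ::
    "'a set \<Rightarrow> ('a \<Rightarrow> 'a \<Rightarrow> 'a \<Rightarrow> 'a) \<Rightarrow> ('a \<times> 'a) set \<Rightarrow> ('a \<times> 'a) set \<Rightarrow> ('a \<times> 'a) set \<Rightarrow> bool"
  where "centralizing X p R S T \<longleftrightarrow> heap_congruence X p T \<and>
    (\<lambda>(x, y, z). T `` {p x y z})
      \<in> heap_hom (fibre_prod R S) (triple_op p) (X // T) (quot_op p T)"

text \<open>The smallest element is taken with respect to inclusion of relations; it exists by
  \<open>heap_commutator_least\<close> below.\<close>

definition heap_commutator ::
    "'a set \<Rightarrow> ('a \<Rightarrow> 'a \<Rightarrow> 'a \<Rightarrow> 'a) \<Rightarrow> ('a \<times> 'a) set \<Rightarrow> ('a \<times> 'a) set \<Rightarrow> ('a \<times> 'a) set"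
  where "heap_commutator X p R S = (LEAST T. centralizing X p R S T)"

definition retract_group :: "'a set \<Rightarrow> ('a \<Rightarrow> 'a \<Rightarrow> 'a \<Rightarrow> 'a) \<Rightarrow> 'a \<Rightarrow> 'a monoid"
  where "retract_group X p e = \<lparr>carrier = X, mult = (\<lambda>x z. p x e z), one = e\<rparr>"

definition commutator_subgroup :: "('a, 'b) monoid_scheme \<Rightarrow> 'a set \<Rightarrow> 'a set \<Rightarrow> 'a set"
  where "commutator_subgroup G N M = generate G
    (\<Union>n \<in> N. \<Union>m \<in> M. {n \<otimes>\<^bsub>G\<^esub> m \<otimes>\<^bsub>G\<^esub> (inv\<^bsub>G\<^esub> n) \<otimes>\<^bsub>G\<^esub> (inv\<^bsub>G\<^esub> m)})"

definition congruence_of :: "'a set \<Rightarrow> ('a \<Rightarrow> 'a \<Rightarrow> 'a \<Rightarrow> 'a) \<Rightarrow> 'a set \<Rightarrow> ('a \<times> 'a) set"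
  where "congruence_of X p C = {(x, y). x \<in> X \<and> y \<in> X \<and> (\<exists>s\<in>C. p x y s \<in> C)}"

definition corresponds ::
    "'a set \<Rightarrow> ('a \<Rightarrow> 'a \<Rightarrow> 'a \<Rightarrow> 'a) \<Rightarrow> 'a \<Rightarrow> ('a \<times> 'a) set \<Rightarrow> 'a set \<Rightarrow> bool"
  where "corresponds X p e T C \<longleftrightarrow>
    heap_congruence X p T \<and> C \<lhd> retract_group X p e \<and> T `` {e} = C"

lemma heap_congruenceD:
  assumes "heap_congruence X p T"
  shows "equiv X T" "T \<subseteq> X \<times> X" "x \<in> X \<Longrightarrow> (x, x) \<in> T"
    "(x, y) \<in> T \<Longrightarrow> (y, x) \<in> T" "\<lbrakk>(x, y) \<in> T; (y, z) \<in> T\<rbrakk> \<Longrightarrow> (x, z) \<in> T"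
    "\<lbrakk>(x, x') \<in> T; (y, y') \<in> T; (z, z') \<in> T\<rbrakk> \<Longrightarrow> (p x y z, p x' y' z') \<in> T"
  using assms unfolding heap_congruence_def equiv_def refl_on_def sym_def
  by (auto dest: transD)

lemma quot_op_class:
  assumes "heap_congruence X p T" "x \<in> X" "y \<in> X" "z \<in> X"
  shows "quot_op p T (T `` {x}) (T `` {y}) (T `` {z}) = T `` {p x y z}"
proof -
  note T = heap_congruenceD[OF assms(1)]
  show ?thesis
    unfolding quot_op_def
    using T(3)[OF assms(2)] T(3)[OF assms(3)] T(3)[OF assms(4)]
    by (auto; meson T(4,5,6))
qed

context heap
begin

lemma quotient_heap:
  assumes T: "heap_congruence X p T"
  shows "heap (X // T) (quot_op p T)"
  by standard
    (auto elim!: quotientE intro!: quotientI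
      simp: quot_op_class[OF T] closed assoc left_cancel right_cancel)

lemma fibre_prod_heap:
  assumes R: "heap_congruence X p R" and S: "heap_congruence X p S"
  shows "heap (fibre_prod R S) (triple_op p)"
proof -
  have *: "x \<in> X \<and> y \<in> X \<and> z \<in> X" if "(x, y, z) \<in> fibre_prod R S" for x y z
    using that heap_congruenceD(2)[OF R] heap_congruenceD(2)[OF S]
    by (auto simp: fibre_prod_def)
  show ?thesis
  proof
    fix a b c assume "a \<in> fibre_prod R S" "b \<in> fibre_prod R S" "c \<in> fibre_prod R S"
    then show "triple_op p a b c \<in> fibre_prod R S"
      by (auto simp: fibre_prod_def triple_op_def
          intro: heap_congruenceD(6)[OF R] heap_congruenceD(6)[OF S])
  qed (auto dest!: * simp: triple_op_def assoc left_cancel right_cancel)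
qed

lemma centralizing_iff:
  assumes R: "heap_congruence X p R" and S: "heap_congruence X p S"
  shows "centralizing X p R S T \<longleftrightarrow> heap_congruence X p T \<and>
    (\<forall>x y z x' y' z' x'' y'' z''. (x, y) \<in> R \<longrightarrow> (y, z) \<in> S \<longrightarrow> (x', y') \<in> R \<longrightarrow> (y', z') \<in> S
      \<longrightarrow> (x'', y'') \<in> R \<longrightarrow> (y'', z'') \<in> S \<longrightarrow>
      (p (p x x' x'') (p y y' y'') (p z z' z''), p (p x y z) (p x' y' z') (p x'' y'' z'')) \<in> T)"
    (is "_ \<longleftrightarrow> _ \<and> ?P")
proof (cases "heap_congruence X p T")
  case T: True
  let ?f = "\<lambda>(x, y, z). T `` {p x y z}"
  have *: "x \<in> X \<and> y \<in> X \<and> z \<in> X" if "(x, y) \<in> R" "(y, z) \<in> S" for x y z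
    using that heap_congruenceD(2)[OF R] heap_congruenceD(2)[OF S] by auto
  have maps: "?f \<in> fibre_prod R S \<rightarrow> X // T"
    by (auto simp: fibre_prod_def dest!: * intro!: quotientI closed)
  have eq: "T `` {a} = T `` {b} \<longleftrightarrow> (a, b) \<in> T" if "a \<in> X" "b \<in> X" for a b
    using eq_equiv_class_iff[OF heap_congruenceD(1)[OF T] that] .
  have "?f (triple_op p (x, y, z) (x', y', z') (x'', y'', z''))
          = quot_op p T (?f (x, y, z)) (?f (x', y', z')) (?f (x'', y'', z'')) \<longleftrightarrow>
        (p (p x x' x'') (p y y' y'') (p z z' z''), p (p x y z) (p x' y' z') (p x'' y'' z'')) \<in> T"
    if "(x, y) \<in> R" "(y, z) \<in> S" "(x', y') \<in> R" "(y', z') \<in> S" "(x'', y'') \<in> R" "(y'', z'') \<in> S"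
    for x y z x' y' z' x'' y'' z''
    using *[OF that(1,2)] *[OF that(3,4)] *[OF that(5,6)]
    by (simp add: triple_op_def quot_op_class[OF T] closed eq)
  then have "(\<forall>a\<in>fibre_prod R S. \<forall>b\<in>fibre_prod R S. \<forall>c\<in>fibre_prod R S.
      ?f (triple_op p a b c) = quot_op p T (?f a) (?f b) (?f c)) \<longleftrightarrow> ?P"
    by (simp add: fibre_prod_def) blast
  with T maps show ?thesis
    by (simp only: centralizing_def heap_hom_def mem_Collect_eq simp_thms)
qed (simp add: centralizing_def)

lemma heap_commutator_least:
  assumes R: "heap_congruence X p R" and S: "heap_congruence X p S"
  shows "centralizing X p R S (heap_commutator X p R S)"
    and "centralizing X p R S T \<Longrightarrow> heap_commutator X p R S \<subseteq> T"
proof -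
  let ?F = "{T. centralizing X p R S T}"
  have "heap_congruence X p (X \<times> X)"
    by (auto simp: heap_congruence_def equiv_def refl_on_def sym_def trans_def closed)
  moreover have "x \<in> X \<and> y \<in> X \<and> z \<in> X" if "(x, y) \<in> R" "(y, z) \<in> S" for x y z
    using that heap_congruenceD(2)[OF R] heap_congruenceD(2)[OF S] by auto
  ultimately have ne: "X \<times> X \<in> ?F"
    by (simp add: centralizing_iff[OF R S] closed)
  have F: "heap_congruence X p T" if "T \<in> ?F" for T
    using that by (simp add: centralizing_def)
  have "heap_congruence X p (\<Inter>?F)"
  proof -
    have "equiv X (\<Inter>?F)"
    proof (rule equivI)
      show "\<Inter>?F \<subseteq> X \<times> X" using ne by blast
      show "refl_on X (\<Inter>?F)"
        using heap_congruenceD(3)[OF F] by (simp add: refl_on_def)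
      show "sym (\<Inter>?F)"
        unfolding sym_def using heap_congruenceD(4)[OF F] by blast
      show "trans (\<Inter>?F)"
        unfolding trans_def using heap_congruenceD(5)[OF F] by blast
    qed
    then show ?thesis
      unfolding heap_congruence_def using heap_congruenceD(6)[OF F] by blast
  qed
  then have inter: "centralizing X p R S (\<Inter>?F)"
    by (simp add: centralizing_iff[OF R S])
  have "heap_commutator X p R S = \<Inter>?F"
    unfolding heap_commutator_def
    by (rule Least_equality) (use inter in auto)
  with inter show "centralizing X p R S (heap_commutator X p R S)"
    and "centralizing X p R S T \<Longrightarrow> heap_commutator X p R S \<subseteq> T"
    by auto
qed

lemma retract_is_group:
  assumes e: "e \<in> X"
  shows "group (retract_group X p e)"
proof (rule groupI)
  fix x assume "x \<in> carrier (retract_group X p e)"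
  then have x: "x \<in> X" by (simp add: retract_group_def)
  have "p (p e x e) e x = e"
    using e x by (simp add: assoc left_cancel right_cancel)
  then show "\<exists>y\<in>carrier (retract_group X p e).
      y \<otimes>\<^bsub>retract_group X p e\<^esub> x = \<one>\<^bsub>retract_group X p e\<^esub>"
    using closed[OF e x e] by (auto simp: retract_group_def)
qed (use e in \<open>auto simp: retract_group_def closed assoc left_cancel\<close>)

lemma class_corresponds:
  assumes e: "e \<in> X" and T: "heap_congruence X p T"
  shows "corresponds X p e T (T `` {e})" and "congruence_of X p (T `` {e}) = T"
proof -
  note D = heap_congruenceD[OF T]
  let ?G = "retract_group X p e"
  interpret G: group ?G by (rule retract_is_group[OF e])
  have inX: "x \<in> X" if "(e, x) \<in> T" for x using that D(2) by auto
  have ee: "p e e e = e" using e by (simp add: left_cancel)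
  have inv: "inv\<^bsub>?G\<^esub> x = p e x e" if "x \<in> X" for x
    by (rule G.inv_equality)
      (use e that in \<open>auto simp: retract_group_def closed assoc left_cancel right_cancel\<close>)
  have "subgroup (T `` {e}) ?G"
  proof (rule G.subgroupI)
    show "T `` {e} \<subseteq> carrier ?G" using inX by (auto simp: retract_group_def)
    show "T `` {e} \<noteq> {}" using D(3)[OF e] by blast
  next
    fix x assume "x \<in> T `` {e}"
    then show "inv\<^bsub>?G\<^esub> x \<in> T `` {e}"
      using D(6)[of e e e x e e] D(3)[OF e] ee inv inX by auto
  next
    fix x y assume "x \<in> T `` {e}" "y \<in> T `` {e}"
    then show "x \<otimes>\<^bsub>?G\<^esub> y \<in> T `` {e}"
      using D(6)[of e x e e e y] D(3)[OF e] ee by (auto simp: retract_group_def)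
  qed
  moreover have "g \<otimes>\<^bsub>?G\<^esub> h \<otimes>\<^bsub>?G\<^esub> inv\<^bsub>?G\<^esub> g \<in> T `` {e}"
    if "g \<in> carrier ?G" "h \<in> T `` {e}" for g h
  proof -
    have g: "g \<in> X" and h: "(e, h) \<in> T" using that by (auto simp: retract_group_def)
    have "(p (p g e e) e (p e g e), p (p g e h) e (p e g e)) \<in> T"
      using g h e by (intro D(6) D(3) closed) auto
    moreover have "p (p g e e) e (p e g e) = e"
      using g e by (simp add: closed right_cancel left_cancel assoc flip: assoc)
    ultimately show ?thesis
      by (simp add: inv[OF g]) (simp add: retract_group_def)
  qed
  ultimately have "T `` {e} \<lhd> ?G"
    by (simp add: G.normal_inv_iff)
  with T show "corresponds X p e T (T `` {e})"
    by (simp add: corresponds_def)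
  show "congruence_of X p (T `` {e}) = T"
  proof (rule Set.set_eqI, simp only: split_paired_all)
    fix x y
    show "(x, y) \<in> congruence_of X p (T `` {e}) \<longleftrightarrow> (x, y) \<in> T"
    proof
      assume "(x, y) \<in> congruence_of X p (T `` {e})"
      then obtain s where x: "x \<in> X" and y: "y \<in> X"
        and s: "(e, s) \<in> T" and xs: "(e, p x y s) \<in> T"
        by (auto simp: congruence_of_def)
      have "(p (p x y s) s y, p e e y) \<in> T"
        using D(6)[OF D(4)[OF xs] D(4)[OF s] D(3)[OF y]] .
      then show "(x, y) \<in> T"
        using x y e inX[OF s] by (simp add: assoc left_cancel right_cancel)
    next
      assume xy: "(x, y) \<in> T"
      then have x: "x \<in> X" and y: "y \<in> X" using D(2) by auto
      have "(p x y e, p y y e) \<in> T"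
        using D(6)[OF xy D(3)[OF y] D(3)[OF e]] .
      then have "(e, p x y e) \<in> T"
        using y e D(4) by (simp add: left_cancel)
      then show "(x, y) \<in> congruence_of X p (T `` {e})"
        using x y D(3)[OF e] by (auto simp: congruence_of_def)
    qed
  qed
qed

end

end

theory Submission
  imports Defs
begin

text \<open>In the group at \<open>e\<close> one has \<open>[x, y, z] = x y\<^sup>-\<^sup>1 z\<close>. A centralizing congruence identifies
  \<open>n m\<close> with \<open>m n\<close>: apply the morphism property to the triples \<open>(e, e, m)\<close>, \<open>(e, e, e)\<close> and
  \<open>(n, e, e)\<close>. Conversely, the two sides of the morphism property for three general triples are
  \<open>u k l v\<close> and \<open>u l k v\<close>, where \<open>k = y' x'\<^sup>-\<^sup>1 x'' y''\<^sup>-\<^sup>1\<close> lies in \<open>N\<close> and \<open>l = y' y\<^sup>-\<^sup>1 z z'\<^sup>-\<^sup>1\<close>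
  lies in \<open>M\<close>, so they agree modulo \<open>[N, M]\<close>.\<close>

text \<open>The generating set is closed under conjugation: conjugating the commutator of
  \<open>n\<close> and \<open>m\<close> by \<open>g\<close> gives the commutator of their
  conjugates, which stay in \<open>N\<close> and \<open>M\<close> by normality.\<close>

lemma (in group) commutator_subgroup_normal:
  assumes N: "N \<lhd> G" and M: "M \<lhd> G"
  shows "commutator_subgroup G N M \<lhd> G"
  unfolding commutator_subgroup_def
proof (rule normal_generateI)
  have sub: "N \<subseteq> carrier G" "M \<subseteq> carrier G"
    using N M by (simp_all add: normal_imp_subgroup subgroup.subset)
  then show "(\<Union>n\<in>N. \<Union>m\<in>M. {n \<otimes> m \<otimes> inv n \<otimes> inv m}) \<subseteq> carrier G"
    by (auto simp: subset_iff)
  fix h g assume h: "h \<in> (\<Union>n\<in>N. \<Union>m\<in>M. {n \<otimes> m \<otimes> inv n \<otimes> inv m})" and g: "g \<in> carrier G"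
  then obtain n m where n: "n \<in> N" and m: "m \<in> M" and h: "h = n \<otimes> m \<otimes> inv n \<otimes> inv m"
    by blast
  let ?n = "g \<otimes> n \<otimes> inv g" and ?m = "g \<otimes> m \<otimes> inv g"
  have "?n \<in> N" "?m \<in> M"
    using N M n m g by (auto simp: normal_inv_iff)
  moreover have "g \<otimes> h \<otimes> inv g = ?n \<otimes> ?m \<otimes> inv ?n \<otimes> inv ?m"
  proof -
    \<comment> \<open>Once products are nested to the right, every inner \<open>inv g\<close> meets
      a \<open>g\<close> in exactly this shape.\<close>
    have "inv g \<otimes> (g \<otimes> x) = x" if "x \<in> carrier G" for x
      using g that by (simp flip: m_assoc)
    then show ?thesis
      using sub n m g by (simp add: h subset_iff m_assoc inv_mult_group)
  qed
  ultimately show "g \<otimes> h \<otimes> inv g \<in> (\<Union>n\<in>N. \<Union>m\<in>M. {n \<otimes> m \<otimes> inv n \<otimes> inv m})"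
    by blast
qed

context heap
begin

lemma op_cancel:
  assumes "x \<in> X" "y \<in> X" "z \<in> X" "w \<in> X"
  shows "p x y (p y z w) = p x z w"
  using assms by (simp add: right_cancel flip: assoc)

text \<open>In group terms, inverting \<open>x y^-1 z\<close> reverses it to
  \<open>z^-1 y x^-1\<close>. Together with \<open>assoc\<close> and \<open>op_cancel\<close> this
  lets heap terms be rewritten to a right-nested form without choosing a base point.\<close>

lemma op_middle:
  assumes "x \<in> X" "y \<in> X" "z \<in> X" "a \<in> X" "b \<in> X"
  shows "p a (p x y z) b = p a z (p y x b)"
proof -
  let ?w = "p x y z"
  have w: "?w \<in> X" using assms by (simp add: closed)
  have "p a z (p y x b) = p a z (p y x (p ?w ?w b))"
    using assms w by (simp add: left_cancel)
  also have "\<dots> = p a z (p (p y x ?w) ?w b)"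
    using assms w by (simp only: assoc)
  also have "p y x ?w = z"
    using assms by (simp add: left_cancel right_cancel flip: assoc)
  also have "p a z (p z ?w b) = p a ?w b"
    using assms w by (simp add: right_cancel flip: assoc)
  finally show ?thesis by simp
qed

lemma retract_group_inv:
  assumes "e \<in> X" "x \<in> X"
  shows "inv\<^bsub>retract_group X p e\<^esub> x = p e x e"
proof -
  interpret G: group "retract_group X p e" by (rule retract_is_group[OF assms(1)])
  show ?thesis
    by (rule G.inv_equality)
      (use assms in \<open>auto simp: retract_group_def closed assoc left_cancel right_cancel\<close>)
qed

text \<open>This dictionary makes the coset calculus of groups available for heap
  congruences.\<close>

lemma heap_op_eq_retract_group:
  assumes "e \<in> X" "x \<in> X" "y \<in> X" "z \<in> X"
  shows "p x y z = x \<otimes>\<^bsub>retract_group X p e\<^esub> inv\<^bsub>retract_group X p e\<^esub> y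
    \<otimes>\<^bsub>retract_group X p e\<^esub> z"
  using assms
  by (simp add: retract_group_inv) (simp add: retract_group_def closed assoc left_cancel op_cancel)

text \<open>If \<open>s\<close> and \<open>x y^-1 s\<close> lie in the subgroup \<open>C\<close>, so
  does \<open>x y^-1\<close>; hence the relation is equality of cosets of \<open>C\<close>, and the
  other two claims are facts about the quotient group.\<close>

lemma congruence_of_normal:
  assumes e: "e \<in> X" and C: "C \<lhd> retract_group X p e"
  shows "(x, y) \<in> congruence_of X p C \<longleftrightarrow> x \<in> X \<and> y \<in> X \<and>
      C #>\<^bsub>retract_group X p e\<^esub> x = C #>\<^bsub>retract_group X p e\<^esub> y" (is ?iff)
    and "heap_congruence X p (congruence_of X p C)"
    and "congruence_of X p C `` {e} = C"
proof -
  let ?G = "retract_group X p e"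
  interpret C: normal C ?G by (rule C)
  have car: "carrier ?G = X" and one: "\<one>\<^bsub>?G\<^esub> = e" by (simp_all add: retract_group_def)
  have CX: "C \<subseteq> X" using C.subset by (simp add: car)
  note op = heap_op_eq_retract_group[OF e]
  have iff: "(x, y) \<in> congruence_of X p C \<longleftrightarrow> x \<in> X \<and> y \<in> X \<and> C #>\<^bsub>?G\<^esub> x = C #>\<^bsub>?G\<^esub> y" for x y
  proof (cases "x \<in> X \<and> y \<in> X")
    case True
    then have x: "x \<in> carrier ?G" and y: "y \<in> carrier ?G" by (simp_all add: car)
    have "(\<exists>s\<in>C. p x y s \<in> C) \<longleftrightarrow> x \<otimes>\<^bsub>?G\<^esub> inv\<^bsub>?G\<^esub> y \<in> C"
    proof
      assume "\<exists>s\<in>C. p x y s \<in> C"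
      then obtain s where s: "s \<in> C" "p x y s \<in> C"
        by blast
      then have "x \<otimes>\<^bsub>?G\<^esub> inv\<^bsub>?G\<^esub> y \<otimes>\<^bsub>?G\<^esub> s \<in> C"
        using op[of x y s] True CX by (simp only: subset_iff)
      then have "x \<otimes>\<^bsub>?G\<^esub> inv\<^bsub>?G\<^esub> y \<otimes>\<^bsub>?G\<^esub> s \<otimes>\<^bsub>?G\<^esub> inv\<^bsub>?G\<^esub> s \<in> C"
        using s(1) by simp
      then show "x \<otimes>\<^bsub>?G\<^esub> inv\<^bsub>?G\<^esub> y \<in> C"
        using s(1) x y C.mem_carrier[OF s(1)] by (simp add: C.m_assoc)
    next
      assume "x \<otimes>\<^bsub>?G\<^esub> inv\<^bsub>?G\<^esub> y \<in> C"
      then have "p x y e \<in> C"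
        using op[of x y e] True e C.r_one[of "x \<otimes>\<^bsub>?G\<^esub> inv\<^bsub>?G\<^esub> y"] x y by (simp add: one)
      then show "\<exists>s\<in>C. p x y s \<in> C"
        using subgroup.one_closed[OF C.subgroup_axioms] by (auto simp: one)
    qed
    also have "\<dots> \<longleftrightarrow> x \<in> C #>\<^bsub>?G\<^esub> y"
      by (rule C.rcos_module[OF C.is_group y x, symmetric])
    also have "\<dots> \<longleftrightarrow> C #>\<^bsub>?G\<^esub> x = C #>\<^bsub>?G\<^esub> y"
      using C.rcos_self[OF x C.subgroup_axioms] C.repr_independence[OF _ y C.subgroup_axioms]
      by blast
    finally show ?thesis using True by (simp add: congruence_of_def)
  qed (auto simp: congruence_of_def)
  then show ?iff .
  show "heap_congruence X p (congruence_of X p C)"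
    unfolding heap_congruence_def
  proof (intro conjI allI impI)
    show "equiv X (congruence_of X p C)"
      by (intro equivI refl_onI symI transI) (auto simp: iff)
  next
    \<comment> \<open>Normality enters here: products and inverses of cosets are well defined, so
      the coset of \<open>p x y z\<close> depends only on the cosets of its arguments.\<close>
    have coset: "C #>\<^bsub>?G\<^esub> p x y z
        = (C #>\<^bsub>?G\<^esub> x) <#>\<^bsub>?G\<^esub> set_inv\<^bsub>?G\<^esub> (C #>\<^bsub>?G\<^esub> y) <#>\<^bsub>?G\<^esub> (C #>\<^bsub>?G\<^esub> z)"
      if "x \<in> X" "y \<in> X" "z \<in> X" for x y z
    proof -
      have "x \<in> carrier ?G" "y \<in> carrier ?G" "z \<in> carrier ?G"
        using that by (simp_all add: car)
      then show ?thesis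
        unfolding op[OF that] by (simp add: C.rcos_sum C.rcos_inv)
    qed
    fix x x' y y' z z'
    assume "(x, x') \<in> congruence_of X p C" "(y, y') \<in> congruence_of X p C"
      "(z, z') \<in> congruence_of X p C"
    then show "(p x y z, p x' y' z') \<in> congruence_of X p C"
      by (simp add: iff closed coset)
  qed
  show "congruence_of X p C `` {e} = C"
  proof -
    have "C #>\<^bsub>?G\<^esub> e = C"
      using C.coset_mult_one[OF C.subset] by (simp add: one)
    then show ?thesis
      using CX e C.rcos_const[OF C.is_group] C.coset_join1[OF _ _ C.subgroup_axioms]
      by (auto simp: iff car)
  qed
qed

text \<open>The lower bound for the commutator. Since the class of \<open>e\<close> is a subgroup,
  only the generators have to be checked.\<close>

lemma commutators_in_centralizing_class:
  assumes R: "heap_congruence X p R" and S: "heap_congruence X p S" and e: "e \<in> X"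
    and T: "centralizing X p R S T"
  shows "commutator_subgroup (retract_group X p e) (R `` {e}) (S `` {e}) \<subseteq> T `` {e}"
proof -
  let ?G = "retract_group X p e"
  interpret G: group ?G by (rule retract_is_group[OF e])
  have car: "carrier ?G = X" by (simp add: retract_group_def)
  have T': "heap_congruence X p T" using T by (simp add: centralizing_def)
  note D = heap_congruenceD[OF T']
  have "T `` {e} \<lhd> ?G"
    using class_corresponds(1)[OF e T'] by (simp add: corresponds_def)
  then have sub: "subgroup (T `` {e}) ?G" by (rule normal_imp_subgroup)
  have "n \<otimes>\<^bsub>?G\<^esub> m \<otimes>\<^bsub>?G\<^esub> inv\<^bsub>?G\<^esub> n \<otimes>\<^bsub>?G\<^esub> inv\<^bsub>?G\<^esub> m \<in> T `` {e}"
    if n: "(e, n) \<in> R" and m: "(e, m) \<in> S" for n m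
  proof -
    have nX: "n \<in> X" and mX: "m \<in> X"
      using n m heap_congruenceD(2)[OF R] heap_congruenceD(2)[OF S] by auto
    \<comment> \<open>The two sides collapse to \<open>n m\<close> and \<open>m n\<close>.\<close>
    have "(p (p e e n) (p e e e) (p m e e), p (p e e m) (p e e e) (p n e e)) \<in> T"
      using T n m heap_congruenceD(3,4)[OF R] heap_congruenceD(3,4)[OF S] e
      unfolding centralizing_iff[OF R S] by blast
    then have "(n \<otimes>\<^bsub>?G\<^esub> m, m \<otimes>\<^bsub>?G\<^esub> n) \<in> T"
      using e nX mX by (simp add: retract_group_def left_cancel right_cancel)
    moreover have inX: "n \<otimes>\<^bsub>?G\<^esub> m \<in> X" "m \<otimes>\<^bsub>?G\<^esub> n \<in> X"
      using G.m_closed nX mX by (auto simp: car)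
    \<comment> \<open>Dividing both sides by \<open>m n\<close> on the right turns the pair into
      \<open>e\<close> and the group commutator of \<open>n\<close> and \<open>m\<close>.\<close>
    ultimately have "(p (m \<otimes>\<^bsub>?G\<^esub> n) (m \<otimes>\<^bsub>?G\<^esub> n) e, p (n \<otimes>\<^bsub>?G\<^esub> m) (m \<otimes>\<^bsub>?G\<^esub> n) e) \<in> T"
      using D(3,4,6) e by meson
    moreover have "p (n \<otimes>\<^bsub>?G\<^esub> m) (m \<otimes>\<^bsub>?G\<^esub> n) e
        = n \<otimes>\<^bsub>?G\<^esub> m \<otimes>\<^bsub>?G\<^esub> inv\<^bsub>?G\<^esub> n \<otimes>\<^bsub>?G\<^esub> inv\<^bsub>?G\<^esub> m"
      using e nX mX by (simp add: retract_group_inv)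
        (simp add: retract_group_def closed assoc op_middle left_cancel right_cancel op_cancel)
    ultimately show ?thesis
      using inX e by (simp add: left_cancel)
  qed
  then show ?thesis
    unfolding commutator_subgroup_def
    by (intro G.generate_subgroup_incl[OF _ sub]) auto
qed

text \<open>The upper bound: modulo \<open>C\<close> the elements of the two classes of
  \<open>e\<close> commute, which is all that the morphism property demands.\<close>

lemma centralizing_congruence_of:
  assumes R: "heap_congruence X p R" and S: "heap_congruence X p S" and e: "e \<in> X"
    and C: "C \<lhd> retract_group X p e"
    and comm: "commutator_subgroup (retract_group X p e) (R `` {e}) (S `` {e}) \<subseteq> C"
  shows "centralizing X p R S (congruence_of X p C)"
  unfolding centralizing_iff[OF R S]
proof (intro conjI allI impI)
  show "heap_congruence X p (congruence_of X p C)"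
    by (rule congruence_of_normal(2)[OF e C])
next
  let ?G = "retract_group X p e"
  interpret C: normal C ?G by (rule C)
  have car: "carrier ?G = X" by (simp add: retract_group_def)
  fix x y z x' y' z' x'' y'' z''
  assume rel: "(x, y) \<in> R" "(y, z) \<in> S" "(x', y') \<in> R" "(y', z') \<in> S" "(x'', y'') \<in> R" "(y'', z'') \<in> S"
  note DR = heap_congruenceD[OF R] and DS = heap_congruenceD[OF S]
  have X: "x \<in> X" "y \<in> X" "z \<in> X" "x' \<in> X" "y' \<in> X" "z' \<in> X" "x'' \<in> X" "y'' \<in> X" "z'' \<in> X"
    using rel DR(2) DS(2) by auto
  \<comment> \<open>The final \<open>e\<close> turns a quotient of heap elements into an element of
    the group at \<open>e\<close>.\<close>
  define k where "k = p (p y' x' x'') y'' e"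
  define l where "l = p (p y' y z) z' e"
  have kX: "k \<in> X" and lX: "l \<in> X"
    using X e by (simp_all add: k_def l_def closed)
  then have kc: "k \<in> carrier ?G" and lc: "l \<in> carrier ?G"
    by (simp_all add: car)
  \<comment> \<open>Replacing \<open>x'\<close> and \<open>x''\<close> by their
    \<open>R\<close>-partners \<open>y'\<close> and \<open>y''\<close> collapses \<open>k\<close> to
    \<open>e\<close>. Likewise, \<open>l\<close> collapses to \<open>e\<close> when \<open>z\<close>
    and \<open>z'\<close> become their \<open>S\<close>-partners \<open>y\<close> and
    \<open>y'\<close>.\<close>
  have "(p (p y' y' y'') y'' e, k) \<in> R"
    unfolding k_def using rel DR(3,4) X e by (intro DR(6)) auto
  then have k: "k \<in> R `` {e}"
    using X e by (simp add: left_cancel)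
  have "(p (p y' y y) y' e, l) \<in> S"
    unfolding l_def using rel DS(3,4) X e by (intro DS(6)) auto
  then have l: "l \<in> S `` {e}"
    using X e by (simp add: left_cancel right_cancel)
  have kl: "k \<otimes>\<^bsub>?G\<^esub> l \<in> carrier ?G" and lk: "l \<otimes>\<^bsub>?G\<^esub> k \<in> carrier ?G"
    using kc lc by simp_all
  have "k \<otimes>\<^bsub>?G\<^esub> l \<otimes>\<^bsub>?G\<^esub> inv\<^bsub>?G\<^esub> k \<otimes>\<^bsub>?G\<^esub> inv\<^bsub>?G\<^esub> l \<in> C"
    using k l by (intro subsetD[OF comm]) (auto simp: commutator_subgroup_def intro!: generate.incl)
  then have "(k \<otimes>\<^bsub>?G\<^esub> l) \<otimes>\<^bsub>?G\<^esub> inv\<^bsub>?G\<^esub> (l \<otimes>\<^bsub>?G\<^esub> k) \<in> C"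
    using kc lc by (simp add: C.inv_mult_group C.m_assoc)
  then have coset: "C #>\<^bsub>?G\<^esub> (k \<otimes>\<^bsub>?G\<^esub> l) = C #>\<^bsub>?G\<^esub> (l \<otimes>\<^bsub>?G\<^esub> k)"
    using C.rcos_module[OF C.is_group lk kl] C.repr_independence[OF _ lk C.subgroup_axioms]
    by blast
  \<comment> \<open>The common outer factors are \<open>x y'^-1\<close> on the left and
    \<open>z''\<close> on the right; cancellation then yields the two sides of the morphism
    property.\<close>
  have "(p x y' (p (k \<otimes>\<^bsub>?G\<^esub> l) e z''), p x y' (p (l \<otimes>\<^bsub>?G\<^esub> k) e z'')) \<in> congruence_of X p C"
  proof -
    note D = heap_congruenceD[OF congruence_of_normal(2)[OF e C]]
    have "(k \<otimes>\<^bsub>?G\<^esub> l, l \<otimes>\<^bsub>?G\<^esub> k) \<in> congruence_of X p C"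
      unfolding congruence_of_normal(1)[OF e C] using kl lk coset by (simp only: car)
    then show ?thesis
      using X e by (intro D(6) D(3))
  qed
  moreover have "p x y' (p (k \<otimes>\<^bsub>?G\<^esub> l) e z'') = p (p x x' x'') (p y y' y'') (p z z' z'')"
    using X e lX kX by (simp add: retract_group_def k_def l_def closed assoc op_middle left_cancel
        right_cancel op_cancel)
  moreover have "p x y' (p (l \<otimes>\<^bsub>?G\<^esub> k) e z'') = p (p x y z) (p x' y' z') (p x'' y'' z'')"
    using X e lX kX by (simp add: retract_group_def k_def l_def closed assoc op_middle left_cancel
        right_cancel op_cancel)
  ultimately show "(p (p x x' x'') (p y y' y'') (p z z' z''), p (p x y z) (p x' y' z') (p x'' y'' z''))
      \<in> congruence_of X p C"
    by simp
qed

end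

theorem theorem4p1:
  fixes X :: "'a set" and p :: "'a \<Rightarrow> 'a \<Rightarrow> 'a \<Rightarrow> 'a"
    and R S :: "('a \<times> 'a) set" and e :: 'a and N M :: "'a set"
  assumes "heap X p"
    and "heap_congruence X p R" and "heap_congruence X p S"
    and "e \<in> X"
    and "N = R `` {e}" and "M = S `` {e}"
  shows "corresponds X p e (heap_commutator X p R S)
           (commutator_subgroup (retract_group X p e) N M)
       \<and> heap_commutator X p R S
           = congruence_of X p (commutator_subgroup (retract_group X p e) N M)"
proof -
  interpret heap X p by fact
  note R = assms(2) and S = assms(3) and e = assms(4)
  let ?G = "retract_group X p e" and ?T = "heap_commutator X p R S"
  let ?C = "commutator_subgroup ?G N M"
  interpret G: group ?G by (rule retract_is_group[OF e])
  have C: "?C \<lhd> ?G"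
    using class_corresponds(1)[OF e R] class_corresponds(1)[OF e S]
    by (intro G.commutator_subgroup_normal) (simp_all add: corresponds_def assms(5,6))
  have "?T \<subseteq> congruence_of X p ?C"
    by (intro heap_commutator_least(2)[OF R S] centralizing_congruence_of[OF R S e C])
      (simp add: assms(5,6))
  then have "?T `` {e} \<subseteq> ?C"
    using congruence_of_normal(3)[OF e C] by blast
  moreover have "?C \<subseteq> ?T `` {e}"
    using commutators_in_centralizing_class[OF R S e heap_commutator_least(1)[OF R S]]
    by (simp add: assms(5,6))
  ultimately have "?T `` {e} = ?C" by blast
  moreover have "heap_congruence X p ?T"
    using heap_commutator_least(1)[OF R S] by (simp add: centralizing_def)
  \<comment> \<open>A congruence is recovered from its class of \<open>e\<close>, so equality of the
    classes settles both conjuncts.\<close>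
  ultimately show ?thesis
    using class_corresponds[OF e] by metis
qed

end
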